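(* Let $A$ be a C*-algebraic quantum group with faithful state $f$, and let $F\colon E_1\to E_2$ be a surjective $A$-linear map between Hilbert $A$-modules. If $F$ has any one of the following four properties, then it has all of them: (1) $F$ is a unitary element of the bounded adjointable operators $\mathcal L(E_1,E_2)$; (2) $F$ is a Hilbert module isomorphism; (3) $F$ is an isometry with respect to the norms on $E_1$ and $E_2$; (4) $f(\langle x,y\rangle_{E_1})=f(\langle Fx,Fy\rangle_{E_2})$ for all $x,y\in E_1$.
   Context: Only the C*-algebra underlying the quantum group and the faithful state $f$ enter the statement; in the paper the quantum groups considered here are of compact type, so $A$ is unital. Hilbert $A$-modules are right modules with $A$-valued inner product $\langle\cdot,\cdot\rangle$, $A$-linear in the second entry, nondegenerate and positive, complete for the norm $\|x\|=\|\langle x,x\rangle\|^{1/2}$. A Hilbert module isomorphism $F\colon E_1\to E_2$ is a bijective $A$-linear map with $\langle x,y\rangle_{E_1}=\langle Fx,Fy\rangle_{E_2}$ for all $x,y$. *)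

theory Defs
  imports "HOL-Analysis.Analysis"
begin

class complex_banach = banach +
  fixes scaleC :: "complex \<Rightarrow> 'a \<Rightarrow> 'a"
  assumes scaleC_add_right: "scaleC c (x + y) = scaleC c x + scaleC c y"
    and scaleC_add_left: "scaleC (c + d) x = scaleC c x + scaleC d x"
    and scaleC_scaleC: "scaleC c (scaleC d x) = scaleC (c * d) x"
    and scaleR_scaleC: "scaleR r x = scaleC (complex_of_real r) x"
    and norm_scaleC: "norm (scaleC c x) = cmod c * norm x"

text \<open>
  Unital C*-algebras. The class real_normed_algebra_1 excludes the zero algebra, which carries
  no state.
\<close>

class cstar_algebra = complex_banach + real_normed_algebra_1 +
  fixes star :: "'a \<Rightarrow> 'a"
  assumes scaleC_mult_left: "scaleC c x * y = scaleC c (x * y)"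
    and scaleC_mult_right: "x * scaleC c y = scaleC c (x * y)"
    and star_add: "star (x + y) = star x + star y"
    and star_scaleC: "star (scaleC c x) = scaleC (cnj c) (star x)"
    and star_mult: "star (x * y) = star y * star x"
    and star_star: "star (star x) = x"
    and norm_star_mult_self: "norm (star x * x) = (norm x)\<^sup>2"

definition spectrum :: "'a::cstar_algebra \<Rightarrow> complex set" where
  "spectrum a = {c. \<not> (\<exists>b. (a - scaleC c 1) * b = 1 \<and> b * (a - scaleC c 1) = 1)}"

definition positive :: "'a::cstar_algebra \<Rightarrow> bool" where
  "positive a \<longleftrightarrow> star a = a \<and> spectrum a \<subseteq> \<real>\<^sub>\<ge>\<^sub>0"

definition state :: "('a::cstar_algebra \<Rightarrow> complex) \<Rightarrow> bool" where
  "state f \<longleftrightarrow>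
     bounded_linear f \<and> (\<forall>c a. f (scaleC c a) = c * f a) \<and>
     (\<forall>a. f (star a * a) \<in> \<real>\<^sub>\<ge>\<^sub>0) \<and> onorm f = 1"

definition faithful_state :: "('a::cstar_algebra \<Rightarrow> complex) \<Rightarrow> bool" where
  "faithful_state f \<longleftrightarrow> state f \<and> (\<forall>a. f (star a * a) = 0 \<longrightarrow> a = 0)"

text \<open>
  Right Hilbert modules. Completeness comes from the sort of \<open>'e\<close>, whose norm is tied to
  the inner product by \<open>norm_eq\<close>.
\<close>

locale hilbert_module =
  fixes act :: "'e::complex_banach \<Rightarrow> 'a::cstar_algebra \<Rightarrow> 'e"
    and ip :: "'e \<Rightarrow> 'e \<Rightarrow> 'a"
  assumes act_add_left: "act (x + y) a = act x a + act y a"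
    and act_add_right: "act x (a + b) = act x a + act x b"
    and act_mult: "act x (a * b) = act (act x a) b"
    and act_one: "act x 1 = x"
    and act_scaleC_left: "act (scaleC c x) a = scaleC c (act x a)"
    and act_scaleC_right: "act x (scaleC c a) = scaleC c (act x a)"
    and ip_add_right: "ip x (y + z) = ip x y + ip x z"
    and ip_act_right: "ip x (act y a) = ip x y * a"
    and ip_star: "star (ip x y) = ip y x"
    and ip_positive: "positive (ip x x)"
    and ip_nondegenerate: "ip x x = 0 \<Longrightarrow> x = 0"
    and norm_eq: "norm x = sqrt (norm (ip x x))"

text \<open>
  Complex linearity of a module map is not required separately: scalar multiplication
  by \<open>c\<close> is the action of \<open>scaleC c 1\<close>.
\<close>

definition module_linear ::
  "('e \<Rightarrow> 'a \<Rightarrow> 'e) \<Rightarrow> ('d \<Rightarrow> 'a \<Rightarrow> 'd) \<Rightarrow>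
   ('e::complex_banach \<Rightarrow> 'd::complex_banach) \<Rightarrow> bool" where
  "module_linear act1 act2 T \<longleftrightarrow>
     (\<forall>x y. T (x + y) = T x + T y) \<and> (\<forall>x a. T (act1 x a) = act2 (T x) a)"

definition is_adjoint ::
  "('e \<Rightarrow> 'e \<Rightarrow> 'a) \<Rightarrow> ('d \<Rightarrow> 'd \<Rightarrow> 'a) \<Rightarrow> ('e \<Rightarrow> 'd) \<Rightarrow> ('d \<Rightarrow> 'e) \<Rightarrow> bool" where
  "is_adjoint ip1 ip2 T S \<longleftrightarrow> (\<forall>x y. ip2 (T x) y = ip1 x (S y))"

definition adjointable_ops ::
  "('e \<Rightarrow> 'a \<Rightarrow> 'e) \<Rightarrow> ('e \<Rightarrow> 'e \<Rightarrow> 'a) \<Rightarrow> ('d \<Rightarrow> 'a \<Rightarrow> 'd) \<Rightarrow> ('d \<Rightarrow> 'd \<Rightarrow> 'a) \<Rightarrow>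
   ('e::complex_banach \<Rightarrow> 'd::complex_banach) set" where
  "adjointable_ops act1 ip1 act2 ip2 =
     {T. module_linear act1 act2 T \<and> bounded_linear T \<and> (\<exists>S. is_adjoint ip1 ip2 T S)}"

text \<open>The adjoint is unique by nondegeneracy, so \<open>S\<close> below is the adjoint of \<open>T\<close>.\<close>

definition unitary_op ::
  "('e \<Rightarrow> 'a \<Rightarrow> 'e) \<Rightarrow> ('e \<Rightarrow> 'e \<Rightarrow> 'a) \<Rightarrow> ('d \<Rightarrow> 'a \<Rightarrow> 'd) \<Rightarrow> ('d \<Rightarrow> 'd \<Rightarrow> 'a) \<Rightarrow>
   ('e::complex_banach \<Rightarrow> 'd::complex_banach) \<Rightarrow> bool" where
  "unitary_op act1 ip1 act2 ip2 T \<longleftrightarrow>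
     T \<in> adjointable_ops act1 ip1 act2 ip2 \<and>
     (\<exists>S. is_adjoint ip1 ip2 T S \<and> S \<circ> T = id \<and> T \<circ> S = id)"

definition hilbert_module_iso ::
  "('e \<Rightarrow> 'a \<Rightarrow> 'e) \<Rightarrow> ('e \<Rightarrow> 'e \<Rightarrow> 'a) \<Rightarrow> ('d \<Rightarrow> 'a \<Rightarrow> 'd) \<Rightarrow> ('d \<Rightarrow> 'd \<Rightarrow> 'a) \<Rightarrow>
   ('e::complex_banach \<Rightarrow> 'd::complex_banach) \<Rightarrow> bool" where
  "hilbert_module_iso act1 ip1 act2 ip2 T \<longleftrightarrow>
     bij T \<and> module_linear act1 act2 T \<and> (\<forall>x y. ip1 x y = ip2 (T x) (T y))"

end

theory Submission
  imports Defs
begin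

text \<open>
  Every condition is reduced to \<open>F\<close> preserving the inner products. If \<open>F\<close> preserves the
  \<open>f\<close>-scalar products, then \<open>d = \<langle>x, y\<rangle> - \<langle>F x, F y\<rangle>\<close> satisfies \<open>f (d a) = 0\<close> for all \<open>a\<close>,
  in particular for the adjoint of \<open>d\<close>, so \<open>d = 0\<close> by faithfulness. If \<open>F\<close> is isometric, then the
  positive elements \<open>h = \<langle>x, x\<rangle>\<close> and \<open>k = \<langle>F x, F x\<rangle>\<close> satisfy \<open>norm (a* h a) = norm (a* k a)\<close>
  for all \<open>a\<close>. Taking \<open>a = (k + e) powr (- 1 / 2)\<close> makes both norms at most \<open>1\<close>, which gives
  \<open>f (y* h y) \<le> f (y* (k + e) y)\<close> for all \<open>y\<close>; letting \<open>e\<close> tend to \<open>0\<close> and exchanging the roles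
  of \<open>h\<close> and \<open>k\<close> yields \<open>f (y* (h - k) y) = 0\<close> for all \<open>y\<close>, hence \<open>h = k\<close> by faithfulness, and
  polarization finishes the proof.
\<close>

subsection \<open>C*-algebras\<close>

lemma scaleC_of_real: "scaleC (complex_of_real r) x = r *\<^sub>R x"
  for x :: "'a::complex_banach"
  by (simp add: scaleR_scaleC)

lemma scaleC_one [simp]: "scaleC 1 x = x" for x :: "'a::complex_banach"
  using scaleC_of_real[of 1 x] by simp

lemma scaleC_zero_left [simp]: "scaleC 0 x = 0" for x :: "'a::complex_banach"
  using scaleC_of_real[of 0 x] by simp

lemma scaleC_minus_left [simp]: "scaleC (- c) x = - scaleC c x" for x :: "'a::complex_banach"
  using scaleC_add_left[of "-c" c x] by (simp add: add_eq_0_iff2)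

lemma scaleC_diff_left: "scaleC (c - d) x = scaleC c x - scaleC d x" for x :: "'a::complex_banach"
  using scaleC_add_left[of c "-d" x] by simp

lemma scaleC_zero_right [simp]: "scaleC c 0 = 0" for c :: complex
  using norm_scaleC[of c 0] by simp

lemma scaleC_minus_right [simp]: "scaleC c (- x) = - scaleC c x" for x :: "'a::complex_banach"
  using scaleC_add_right[of c "-x" x] by (simp add: add_eq_0_iff2)

lemma scaleC_diff_right: "scaleC c (x - y) = scaleC c x - scaleC c y" for x :: "'a::complex_banach"
  using scaleC_add_right[of c x "-y"] by simp

lemma star_scaleR: "star (r *\<^sub>R x) = r *\<^sub>R star x" for x :: "'a::cstar_algebra"
  by (simp add: scaleR_scaleC star_scaleC)

lemma star_zero [simp]: "star 0 = (0 :: 'a::cstar_algebra)"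
  using star_scaleR[of 0 0] by simp

lemma star_minus: "star (- x) = - star x" for x :: "'a::cstar_algebra"
  using star_scaleR[of "-1" x] by simp

lemma star_diff: "star (x - y) = star x - star y" for x :: "'a::cstar_algebra"
  using star_add[of x "-y"] by (simp add: star_minus)

lemma star_one [simp]: "star 1 = (1 :: 'a::cstar_algebra)"
  using star_mult[of "star 1" "1 :: 'a"] by (simp add: star_star)

lemma norm_star: "norm (star x) = norm x" for x :: "'a::cstar_algebra"
proof -
  have *: "norm y \<le> norm (star y)" for y :: 'a
  proof (cases "y = 0")
    case False
    have "norm y * norm y \<le> norm (star y) * norm y"
      using norm_mult_ineq[of "star y" y] norm_star_mult_self[of y] by (simp add: power2_eq_square)
    then show ?thesis using False by simp
  qed simp
  show ?thesis using *[of x] *[of "star x"] by (simp add: star_star)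
qed

lemma bounded_linear_star: "bounded_linear (star :: 'a::cstar_algebra \<Rightarrow> 'a)"
  by (rule bounded_linear_intro[where K = 1]) (simp_all add: star_add star_scaleR norm_star)

lemma star_power: "star (x ^ n) = star x ^ n" for x :: "'a::cstar_algebra"
  by (induction n) (simp_all add: star_mult power_commutes)

lemma norm_power2_self_adjoint:
  fixes a :: "'a::cstar_algebra"
  assumes "star a = a"
  shows "norm (a ^ 2) = norm a ^ 2"
  using norm_star_mult_self[of a] assms by (simp add: power2_eq_square)

text \<open>This iterates the C*-identity. A self-adjoint element of norm 1 keeps norm 1 under
  repeated squaring, which is what contradicts the decay of the resolvent parameter below.\<close>

lemma norm_power_self_adjoint:
  fixes a :: "'a::cstar_algebra"
  assumes "star a = a"
  shows "norm (a ^ (2 ^ m)) = norm a ^ (2 ^ m)"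
proof (induction m)
  case (Suc m)
  have "a ^ (2 ^ Suc m) = (a ^ (2 ^ m)) ^ 2" by (simp add: power_mult [symmetric] mult.commute)
  then have "norm (a ^ (2 ^ Suc m)) = norm (a ^ (2 ^ m)) ^ 2"
    using norm_power2_self_adjoint[of "a ^ (2 ^ m)"] assms by (simp add: star_power)
  then show ?case using Suc by (simp add: power_mult [symmetric] mult.commute)
qed simp

subsection \<open>The spectral radius of self-adjoint elements\<close>

definition inverse_pair :: "'a::ring_1 \<Rightarrow> 'a \<Rightarrow> bool" where
  "inverse_pair a b \<longleftrightarrow> a * b = 1 \<and> b * a = 1"

lemma spectrum_iff: "c \<in> spectrum a \<longleftrightarrow> \<not> (\<exists>b. inverse_pair (a - scaleC c 1) b)"
  by (simp add: spectrum_def inverse_pair_def)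

lemma inverse_pair_scaleC:
  fixes a :: "'a::cstar_algebra"
  assumes "inverse_pair a b" "c \<noteq> 0"
  shows "inverse_pair (scaleC c a) (scaleC (1 / c) b)"
  using assms by (simp add: inverse_pair_def scaleC_mult_left scaleC_mult_right scaleC_scaleC)

lemma inverse_pair_mult:
  assumes "inverse_pair a b" "inverse_pair c d"
  shows "inverse_pair (a * c) (d * b)"
  using assms unfolding inverse_pair_def by (metis mult.assoc mult_1_right)

text \<open>Resolvent identity: insert the two products that equal 1. In the form
  \<open>1 - scaleC z a\<close> the resolvent also makes sense at the point at infinity of the
  spectral plane, which becomes \<open>z = 0\<close>.\<close>

lemma resolvent_diff:
  fixes a :: "'a::cstar_algebra"
  assumes "inverse_pair (1 - scaleC z a) r" "inverse_pair (1 - scaleC w a) s"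
  shows "r - s = scaleC (z - w) (r * a * s)"
proof -
  have "r - s = r * ((1 - scaleC w a) * s) - (r * (1 - scaleC z a)) * s"
    using assms by (simp add: inverse_pair_def)
  also have "\<dots> = scaleC (z - w) (r * a * s)"
    by (simp add: algebra_simps scaleC_mult_left scaleC_mult_right scaleC_diff_left)
  finally show ?thesis .
qed

text \<open>The resolvent identity bounds the difference by \<open>cmod (z - w)\<close> times norms
  of resolvents. Continuity on the compact disc bounds these norms by some \<open>K\<close>, so
  \<open>K * norm a * K\<close> is a Lipschitz constant.\<close>

lemma resolvent_lipschitz:
  fixes a :: "'a::cstar_algebra"
  assumes R: "\<And>z. cmod z \<le> 1 \<Longrightarrow> inverse_pair (1 - scaleC z a) (R z)"
  shows "\<exists>L\<ge>0. \<forall>z w. cmod z \<le> 1 \<longrightarrow> cmod w \<le> 1 \<longrightarrow> norm (R z - R w) \<le> L * cmod (z - w)"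
proof -
  have ineq: "norm (R z - R w) \<le> cmod (z - w) * (norm (R z) * norm a * norm (R w))"
    if "cmod z \<le> 1" "cmod w \<le> 1" for z w
  proof -
    have "norm (R z * a * R w) \<le> norm (R z) * norm a * norm (R w)"
      by (metis norm_mult_ineq mult_right_mono norm_ge_zero order_trans)
    then show ?thesis
      unfolding resolvent_diff[OF R[OF that(1)] R[OF that(2)]] norm_scaleC
      by (simp add: mult_left_mono)
  qed
  \<comment> \<open>The bound in \<open>ineq\<close> contains \<open>R z\<close> itself; close to
    \<open>w\<close> its factor is at most 1/2 and can be absorbed on the left.\<close>
  have loc: "norm (R z) \<le> 2 * norm (R w)"
    if "cmod z \<le> 1" "cmod w \<le> 1" "cmod (z - w) * (norm a * norm (R w)) \<le> 1/2" for z w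
  proof -
    have "norm (R z) \<le> norm (R w) + norm (R z - R w)"
      by (simp add: norm_triangle_sub)
    also have "norm (R z - R w) \<le> norm (R z) * (cmod (z - w) * (norm a * norm (R w)))"
      using ineq[OF that(1,2)] by (simp add: mult_ac)
    also have "\<dots> \<le> norm (R z) * (1/2)"
      using that(3) by (intro mult_left_mono) auto
    finally show ?thesis by simp
  qed
  have cont: "continuous_on (cball 0 1) R"
    unfolding continuous_on_def
  proof
    fix w :: complex assume w: "w \<in> cball 0 1"
    let ?N = "norm a * norm (R w)"
    have lim: "((\<lambda>z. cmod (z - w) * (2 * ?N * norm (R w))) \<longlongrightarrow> 0) (at w within cball 0 1)"
      by (rule tendsto_eq_intros refl | simp)+
    have "((\<lambda>z. cmod (z - w) * ?N) \<longlongrightarrow> 0) (at w within cball 0 1)"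
      by (rule tendsto_eq_intros refl | simp)+
    then have "\<forall>\<^sub>F z in at w within cball 0 1. cmod (z - w) * ?N < 1/2"
      by (rule order_tendstoD) simp
    moreover have "\<forall>\<^sub>F z in at w within cball 0 1. z \<in> cball 0 1"
      by (simp add: eventually_at_filter)
    ultimately have "\<forall>\<^sub>F z in at w within cball 0 1.
        norm (R z - R w) \<le> cmod (z - w) * (2 * ?N * norm (R w))"
    proof eventually_elim
      case (elim z)
      have z: "cmod z \<le> 1" "cmod w \<le> 1" using elim w by auto
      have "norm (R z) * norm a * norm (R w) \<le> 2 * norm (R w) * norm a * norm (R w)"
        using loc[OF z] elim by (intro mult_right_mono) auto
      then have "cmod (z - w) * (norm (R z) * norm a * norm (R w))
          \<le> cmod (z - w) * (2 * norm (R w) * norm a * norm (R w))"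
        by (rule mult_left_mono) simp
      then show ?case using ineq[OF z] by (simp add: mult_ac)
    qed
    then have "((\<lambda>z. R z - R w) \<longlongrightarrow> 0) (at w within cball 0 1)"
      by (rule Lim_null_comparison[OF _ lim])
    then show "(R \<longlongrightarrow> R w) (at w within cball 0 1)"
      by (rule LIM_zero_cancel)
  qed
  have "bounded (R ` cball 0 1)"
    using compact_continuous_image[OF cont] by (simp add: compact_imp_bounded)
  then obtain K where "\<forall>x\<in>R ` cball 0 1. norm x \<le> K"
    unfolding bounded_iff by blast
  then have K: "norm (R z) \<le> K" if "cmod z \<le> 1" for z
    using that by simp
  have K0: "0 \<le> K" using K[of 0] norm_ge_zero order_trans by (metis norm_zero zero_le_one)
  show ?thesis
  proof (intro exI[of _ "K * norm a * K"] conjI allI impI)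
    fix z w :: complex assume zw: "cmod z \<le> 1" "cmod w \<le> 1"
    have "norm (R z) * norm a * norm (R w) \<le> K * norm a * K"
      using K[OF zw(1)] K[OF zw(2)] K0 by (intro mult_mono) auto
    then have "cmod (z - w) * (norm (R z) * norm a * norm (R w)) \<le> cmod (z - w) * (K * norm a * K)"
      by (rule mult_left_mono) simp
    then show "norm (R z - R w) \<le> K * norm a * K * cmod (z - w)"
      using ineq[OF zw] by (simp add: mult_ac)
  qed (use K0 in simp)
qed

text \<open>Partial fractions: multiplying \<open>1 - b ^ 2\<close> by either inverse leaves the
  other factor, and these two factors add up to 2.\<close>

lemma inverse_pair_halving:
  fixes b :: "'a::cstar_algebra"
  assumes "inverse_pair (1 - b) r" "inverse_pair (1 + b) s"
  shows "inverse_pair (1 - b ^ 2) ((1/2) *\<^sub>R (r + s))"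
proof -
  have e: "1 - b ^ 2 = (1 - b) * (1 + b)" "1 - b ^ 2 = (1 + b) * (1 - b)"
    by (simp_all add: algebra_simps power2_eq_square)
  have "(1 - b ^ 2) * r = 1 + b" "r * (1 - b ^ 2) = 1 + b"
    "(1 - b ^ 2) * s = 1 - b" "s * (1 - b ^ 2) = 1 - b"
    using assms unfolding inverse_pair_def by (metis e mult.assoc mult_1_left mult_1_right)+
  then show ?thesis
    unfolding inverse_pair_def
    by (simp add: distrib_left distrib_right scaleR_2 [symmetric])
qed

text \<open>
  Closeness of the resolvent at \<open>z\<close> and \<open>t z\<close> is inherited by all powers \<open>a ^ (2 ^ m)\<close> with
  the same bound, since \<open>1 / (1 - b\<^sup>2)\<close> is the mean of \<open>1 / (1 - b)\<close> and \<open>1 / (1 + b)\<close>. This is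
  Rickart's averaging over roots of unity, and replaces complex analysis in the spectral radius
  formula.
\<close>

lemma averaged_resolvent:
  fixes a :: "'a::cstar_algebra" and t :: real and z :: complex
  assumes "\<And>z :: complex. cmod z \<le> 1 \<Longrightarrow> \<exists>r s. inverse_pair (1 - scaleC z a) r \<and>
      inverse_pair (1 - scaleC (t * z) a) s \<and> norm (r - s) \<le> \<delta>"
    and "cmod z \<le> 1"
  shows "\<exists>r s. inverse_pair (1 - scaleC z (a ^ (2 ^ m))) r \<and>
      inverse_pair (1 - scaleC (t ^ (2 ^ m) * z) (a ^ (2 ^ m))) s \<and> norm (r - s) \<le> \<delta>"
  using assms(2)
proof (induction m arbitrary: z)
  case 0
  then show ?case using assms(1) by simp
next
  case (Suc m)
  let ?b = "a ^ (2 ^ m)" and ?\<tau> = "complex_of_real (t ^ (2 ^ m))"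
  \<comment> \<open>The induction hypothesis is used at both square roots \<open>w\<close> and
    \<open>- w\<close> of \<open>z\<close>, which lie in the disc as well.\<close>
  define w where "w = csqrt z"
  have w: "cmod w \<le> 1" "cmod (- w) \<le> 1" using Suc.prems by (simp_all add: w_def)
  have sq: "a ^ (2 ^ Suc m) = ?b ^ 2" "t ^ (2 ^ Suc m) = (t ^ (2 ^ m)) ^ 2"
    by (simp_all add: power_mult [symmetric] mult.commute)
  have sq_scale: "(scaleC c x) ^ 2 = scaleC (c ^ 2) (x ^ 2)" for c and x :: 'a
    by (simp add: power2_eq_square scaleC_mult_left scaleC_mult_right scaleC_scaleC)
  obtain r1 s1 where 1: "inverse_pair (1 - scaleC w ?b) r1"
      "inverse_pair (1 - scaleC (?\<tau> * w) ?b) s1" "norm (r1 - s1) \<le> \<delta>"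
    using Suc.IH[OF w(1)] by auto
  obtain r2 s2 where 2: "inverse_pair (1 + scaleC w ?b) r2"
      "inverse_pair (1 + scaleC (?\<tau> * w) ?b) s2" "norm (r2 - s2) \<le> \<delta>"
    using Suc.IH[OF w(2)] by auto
  have "inverse_pair (1 - scaleC z (a ^ (2 ^ Suc m))) ((1/2) *\<^sub>R (r1 + r2))"
    using inverse_pair_halving[OF 1(1) 2(1)] by (simp only: sq sq_scale) (simp add: w_def)
  moreover have "inverse_pair (1 - scaleC (t ^ (2 ^ Suc m) * z) (a ^ (2 ^ Suc m)))
      ((1/2) *\<^sub>R (s1 + s2))"
    using inverse_pair_halving[OF 1(2) 2(2)]
    by (simp only: sq sq_scale) (simp add: w_def power_mult_distrib)
  moreover have "norm ((1/2) *\<^sub>R (r1 + r2) - (1/2) *\<^sub>R (s1 + s2)) \<le> \<delta>"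
  proof -
    have "norm ((1/2) *\<^sub>R (r1 + r2) - (1/2) *\<^sub>R (s1 + s2))
        = norm ((1/2) *\<^sub>R ((r1 - s1) + (r2 - s2)))"
      by (simp add: algebra_simps)
    also have "\<dots> = (1/2) * norm ((r1 - s1) + (r2 - s2))" by simp
    also have "\<dots> \<le> \<delta>" using norm_triangle_ineq[of "r1 - s1" "r2 - s2"] 1(3) 2(3) by simp
    finally show ?thesis .
  qed
  ultimately show ?case by blast
qed

text \<open>If all resolvents existed, averaging would keep those of \<open>b = a ^ (2 ^ m)\<close>
  at 1 and at \<open>t ^ (2 ^ m)\<close> within 1/5 of each other. The second is close to 1, hence
  so is the first, which is impossible because \<open>norm b = 1\<close>.\<close>

lemma resolvent_singular_in_disc:
  fixes a :: "'a::cstar_algebra"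
  assumes sa: "star a = a" and na: "norm a = 1"
  shows "\<exists>z. cmod z \<le> 1 \<and> (\<nexists>r. inverse_pair (1 - scaleC z a) r)"
proof (rule ccontr)
  assume "\<not> ?thesis"
  then obtain R where R: "\<And>z. cmod z \<le> 1 \<Longrightarrow> inverse_pair (1 - scaleC z a) (R z)"
    by metis
  obtain L where L: "0 \<le> L"
    "\<And>z w. cmod z \<le> 1 \<Longrightarrow> cmod w \<le> 1 \<Longrightarrow> norm (R z - R w) \<le> L * cmod (z - w)"
    using resolvent_lipschitz[of a R] R by blast
  \<comment> \<open>Chosen so that moving from \<open>z\<close> to \<open>t * z\<close> changes the
    resolvent by at most 1/5; \<open>L + 1\<close> avoids dividing by zero.\<close>
  define t where "t = 1 - 1 / (5 * (L + 1))"
  have t: "0 < t" "t < 1" using L(1) by (auto simp: t_def field_simps)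
  have dt: "L * (1 - t) \<le> 1/5" using L(1) by (auto simp: t_def field_simps)
  have key: "\<exists>r s. inverse_pair (1 - scaleC z a) r \<and>
      inverse_pair (1 - scaleC (t * z) a) s \<and> norm (r - s) \<le> 1/5" if z: "cmod z \<le> 1" for z :: complex
  proof -
    have tz: "cmod (t * z) \<le> 1" using t z by (simp add: norm_mult mult_le_one)
    have "cmod (z - t * z) = (1 - t) * cmod z"
    proof -
      have "z - t * z = complex_of_real (1 - t) * z" by (simp add: algebra_simps)
      then show ?thesis using t by (metis norm_mult norm_of_real abs_of_pos diff_gt_0_iff_gt)
    qed
    also have "\<dots> \<le> (1 - t) * 1" using t z by (intro mult_left_mono) auto
    finally have "L * cmod (z - t * z) \<le> L * (1 - t)" using L(1) by (simp add: mult_left_mono)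
    then have "norm (R z - R (t * z)) \<le> 1/5" using L(2)[OF z tz] dt by linarith
    then show ?thesis using R[OF z] R[OF tz] by blast
  qed
  have "(\<lambda>n. t ^ n) \<longlonglongrightarrow> 0" using t by (intro LIMSEQ_realpow_zero) auto
  then have "\<forall>\<^sub>F n in sequentially. t ^ n < 1/6" by (rule order_tendstoD) simp
  then obtain m where m: "\<And>n. n \<ge> m \<Longrightarrow> t ^ n < 1/6" unfolding eventually_sequentially by blast
  define \<tau> where "\<tau> = t ^ (2 ^ m)"
  have \<tau>: "0 \<le> \<tau>" "\<tau> < 1/6" using m[of "2 ^ m"] t by (auto simp: \<tau>_def)
  define b where "b = a ^ (2 ^ m)"
  have nb: "norm b = 1" using norm_power_self_adjoint[OF sa] na by (simp add: b_def)
  obtain r s where rs: "inverse_pair (1 - scaleC 1 b) r"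
      "inverse_pair (1 - scaleC \<tau> b) s" "norm (r - s) \<le> 1/5"
    using averaged_resolvent[of a t "1/5" 1 m] key by (auto simp: b_def \<tau>_def)
  \<comment> \<open>\<open>s - 1 = scaleC \<tau> (b * s)\<close> gives
    \<open>norm (s - 1) \<le> (1 + norm (s - 1)) / 6\<close>, that is, at most 1/5.\<close>
  have small: "norm (s - 1) * (5/6) \<le> 1/6"
  proof -
    have "s - 1 = scaleC \<tau> (b * s)" using rs(2)
      by (simp add: inverse_pair_def algebra_simps scaleC_mult_left)
    then have "norm (s - 1) = \<tau> * norm (b * s)" using \<tau> by (simp add: norm_scaleC)
    also have "\<dots> \<le> 1/6 * norm s"
      using \<tau> norm_mult_ineq[of b s] nb by (intro mult_mono) auto
    also have "norm s \<le> 1 + norm (s - 1)" using norm_triangle_sub[of s 1] by simp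
    finally show ?thesis by simp
  qed
  define e where "e = r - 1"
  have e: "norm e \<le> 2/5" using norm_triangle_ineq[of "r - s" "s - 1"] rs(3) small
    by (simp add: e_def)
  \<comment> \<open>Expand \<open>(1 - b) * (1 + e) = 1\<close>. With
    \<open>norm e \<le> 2/5\<close> this yields \<open>norm b \<le> 4/5\<close>.\<close>
  have "b = e - b * e" using rs(1) by (simp add: inverse_pair_def algebra_simps e_def)
  then have "norm b \<le> norm e + norm b * norm e"
    by (metis norm_triangle_ineq4 norm_mult_ineq add_left_mono order_trans)
  then show False using nb e by simp
qed

text \<open>After scaling to norm 1, a nonzero \<open>z\<close> in the disc corresponds to
  \<open>c = norm a / z\<close>, whose modulus is at least \<open>norm a\<close>; at
  \<open>z = 0\<close> the resolvent is trivially 1.\<close>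

lemma self_adjoint_spectral_radius:
  fixes a :: "'a::cstar_algebra"
  assumes sa: "star a = a" and "a \<noteq> 0"
  obtains c where "c \<in> spectrum a" "cmod c \<ge> norm a"
proof -
  have na: "norm a > 0" using assms by simp
  let ?a = "(1 / norm a) *\<^sub>R a"
  have "\<exists>c \<in> spectrum a. cmod c \<ge> norm a"
  proof (rule ccontr)
    assume H: "\<not> ?thesis"
    have "\<exists>r. inverse_pair (1 - scaleC z ?a) r" if z: "cmod z \<le> 1" for z :: complex
    proof (cases "z = 0")
      case True
      then show ?thesis by (auto simp: inverse_pair_def intro!: exI[of _ 1])
    next
      case False
      define c where "c = norm a / z"
      have "cmod c \<ge> norm a" using na z False by (simp add: c_def norm_divide le_divide_eq mult_left_le)
      then have "c \<notin> spectrum a" using H by auto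
      then obtain r where r: "inverse_pair (a - scaleC c 1) r" unfolding spectrum_iff by blast
      have c0: "- (1 / c) \<noteq> 0" using na False by (simp add: c_def)
      have "scaleC (- (1 / c)) (a - scaleC c 1) = 1 - scaleC z ?a"
        using na False by (simp add: c_def scaleC_diff_right scaleC_scaleC scaleR_scaleC)
      then show ?thesis using inverse_pair_scaleC[OF r c0] by auto
    qed
    then show False using resolvent_singular_in_disc[of ?a] na by (auto simp: star_scaleR sa)
  qed
  then show ?thesis using that by blast
qed


subsection \<open>Square roots and positivity of states\<close>

text \<open>Consecutive coefficients have a ratio of modulus \<open>(n + 1/2) / (n + 1)\<close>,
  which is below 1. The binomial series is thus dominated by a geometric one.\<close>

lemma gbinomial_half_bound:
  "\<bar>(- 1 / 2 :: real) gchoose n\<bar> \<le> 1"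
proof (induction n)
  case (Suc n)
  have "of_nat (Suc n) * ((- 1/2 :: real) gchoose Suc n) = (- 1/2 - real n) * ((- 1/2) gchoose n)"
    using gbinomial_mult_1[of "- 1/2 :: real" n] by (simp add: algebra_simps)
  then have "real (Suc n) * \<bar>(- 1/2 :: real) gchoose Suc n\<bar>
      = \<bar>- 1/2 - real n\<bar> * \<bar>(- 1/2 :: real) gchoose n\<bar>"
    by (metis abs_mult abs_of_nat)
  also have "\<dots> \<le> real (Suc n) * 1"
    using Suc by (intro mult_mono) auto
  finally show ?case by (simp del: of_nat_Suc)
qed simp

text \<open>By Vandermonde's convolution the Cauchy square of the binomial series is the geometric
  series of \<open>h\<close>. The inverse root also yields the root, as \<open>c * (1 - h)\<close>,
  and the invertibility of \<open>1 - h\<close>.\<close>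

lemma self_adjoint_inverse_sqrt:
  fixes h :: "'a::cstar_algebra"
  assumes sa: "star h = h" and nh: "norm h < 1"
  obtains c where "star c = c" "c * h = h * c" "inverse_pair (1 - h) (c * c)"
proof -
  \<comment> \<open>the binomial series of \<open>(1 - h) powr (- 1 / 2)\<close>\<close>
  define q where "q n = ((- 1/2 :: real) gchoose n) *\<^sub>R (- h) ^ n" for n
  have nq: "norm (q n) \<le> norm h ^ n" for n
  proof -
    have "norm (q n) = \<bar>(- 1/2 :: real) gchoose n\<bar> * norm ((- h) ^ n)" by (simp add: q_def)
    also have "\<dots> \<le> 1 * norm h ^ n"
      using norm_power_ineq[of "- h" n] gbinomial_half_bound[of n] by (intro mult_mono) auto
    finally show ?thesis by simp
  qed
  have sn: "summable (\<lambda>n. norm (q n))"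
    by (rule summable_comparison_test'[of "\<lambda>n. norm h ^ n" 0])
      (use nq nh in \<open>auto intro: summable_geometric\<close>)
  then have sq: "summable q" by (rule summable_norm_cancel)
  define c where "c = suminf q"
  have c: "q sums c" using sq by (simp add: c_def summable_sums)
  have "(\<lambda>n. star (q n)) sums star c"
    by (rule bounded_linear.sums[OF bounded_linear_star c])
  moreover have "star (q n) = q n" for n by (simp add: q_def star_scaleR star_power star_minus sa)
  ultimately have "star c = c" using c by (simp add: sums_unique2)
  moreover have comm: "c * h = h * c"
  proof -
    have "q n * h = h * q n" for n
      by (simp add: q_def power_commuting_commutes)
    then show ?thesis
      using sums_mult2[OF c, of h] sums_mult[OF c, of h] by (simp add: sums_unique2)
  qed
  moreover have "inverse_pair (1 - h) (c * c)"
  proof -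
    have "(\<Sum>i\<le>n. q i * q (n - i)) = h ^ n" for n
    proof -
      have "(\<Sum>i\<le>n. q i * q (n - i)) =
          (\<Sum>i\<le>n. ((- 1/2 :: real) gchoose i) * ((- 1/2) gchoose (n - i))) *\<^sub>R (- h) ^ n"
        by (simp add: q_def scaleR_sum_left power_add [symmetric] mult.commute)
      also have "\<dots> = ((- 1 :: real) gchoose n) *\<^sub>R (- h) ^ n"
        using gbinomial_Vandermonde[of "- 1/2 :: real" "- 1/2" n] by (simp add: atMost_atLeast0)
      \<comment> \<open>\<open>- 1\<close> over \<open>n\<close> equals \<open>(- 1) ^ n\<close>,
        which cancels the sign of \<open>(- h) ^ n\<close>.\<close>
      also have "\<dots> = h ^ n"
        using gbinomial_minus[of "1 :: real" n] scaleR_power[of "-1" h n]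
        by (simp add: binomial_gbinomial [symmetric] power_mult_distrib [symmetric])
      finally show ?thesis .
    qed
    then have cc: "(\<lambda>n. h ^ n) sums (c * c)"
      using Cauchy_product_sums[OF sn sn] by (simp add: c_def)
    have "(\<lambda>n. h ^ Suc n) sums (c * c - 1)"
      using cc by (subst sums_Suc_iff) simp
    moreover have "(\<lambda>n. h ^ Suc n) sums (h * (c * c))" using sums_mult[OF cc, of h] by simp
    ultimately have 1: "h * (c * c) = c * c - 1" using sums_unique2 by blast
    moreover have "c * c * h = h * (c * c)" by (metis comm mult.assoc)
    ultimately show ?thesis by (simp add: inverse_pair_def algebra_simps)
  qed
  ultimately show ?thesis using that by blast
qed

lemma state_facts:
  assumes "state f"
  shows "f (x + y) = f x + f y" "f (x - y) = f x - f y" "f (r *\<^sub>R x) = r *\<^sub>R f x"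
    "f (scaleC c x) = c * f x" "Re (f (star x * x)) \<ge> 0" "Im (f (star x * x)) = 0"
proof -
  have bl: "bounded_linear f" and p: "f (star x * x) \<in> \<real>\<^sub>\<ge>\<^sub>0"
    using assms by (auto simp: state_def)
  show "f (x + y) = f x + f y" "f (x - y) = f x - f y" "f (r *\<^sub>R x) = r *\<^sub>R f x"
    using bl by (simp_all add: linear_simps)
  show "f (scaleC c x) = c * f x" using assms by (simp add: state_def)
  show "Re (f (star x * x)) \<ge> 0" "Im (f (star x * x)) = 0"
    using p by (auto simp: complex_nonneg_Reals_iff)
qed

text \<open>For \<open>C > norm h\<close> the element \<open>1 - h / C\<close> has the form
  \<open>star b * b\<close>, so \<open>f\<close> is nonnegative on its conjugate by
  \<open>x\<close>. The strict inequality makes the binomial series converge; then \<open>C\<close>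
  tends to \<open>norm h\<close> from the right.\<close>

lemma state_conjugate_le:
  assumes f: "state f" and sa: "star h = h"
  shows "Re (f (star x * h * x)) \<le> norm h * Re (f (star x * x))"
proof -
  have *: "Re (f (star x * h * x)) \<le> C * Re (f (star x * x))" if C: "norm h < C" for C
  proof -
    have C0: "C > 0" using C norm_ge_zero[of h] by linarith
    let ?h = "(1 / C) *\<^sub>R h"
    obtain c where c: "star c = c" "c * ?h = ?h * c" "inverse_pair (1 - ?h) (c * c)"
      by (rule self_adjoint_inverse_sqrt[of ?h]) (use sa C C0 in \<open>auto simp: star_scaleR\<close>)
    define b where "b = c * (1 - ?h)"
    have comm: "c * (1 - ?h) = (1 - ?h) * c" using c(2) by (simp only: left_diff_distrib right_diff_distrib mult_1_left mult_1_right)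
    have "star b * b = (1 - ?h) * (c * c) * (1 - ?h)"
      by (simp add: b_def star_mult star_diff star_scaleR sa c(1) mult.assoc)
    also have "\<dots> = 1 - ?h" using c(3) by (simp add: inverse_pair_def)
    finally have b: "star b * b = 1 - ?h" .
    have "star (b * x) * (b * x) = star x * x - (1 / C) *\<^sub>R (star x * h * x)"
    proof -
      have "star (b * x) * (b * x) = star x * (star b * b) * x" by (simp add: star_mult mult.assoc)
      then show ?thesis by (simp add: b algebra_simps)
    qed
    then have "0 \<le> Re (f (star x * x)) - (1 / C) * Re (f (star x * h * x))"
      using state_facts(5)[OF f, of "b * x"] by (simp add: state_facts[OF f])
    then show ?thesis using C0 by (simp add: field_simps)
  qed
  have "((\<lambda>C. C * Re (f (star x * x))) \<longlongrightarrow> norm h * Re (f (star x * x))) (at_right (norm h))"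
    by (intro tendsto_intros)
  then show ?thesis
    by (rule tendsto_lowerbound)
      (use * in \<open>auto simp: eventually_at_filter\<close>)
qed

text \<open>\<open>a\<close> is the inverse root of \<open>k + e\<close>. Both norm bounds come from
  the spectral radius: the spectrum of \<open>k\<close> is carried over to
  \<open>1 - (k + e) / M\<close> and to \<open>a * k * a = k / (k + e)\<close>.\<close>

lemma positive_inverse_sqrt:
  fixes k :: "'a::cstar_algebra"
  assumes k: "positive k" and e: "e > 0"
  obtains a where "star a = a" "a * k = k * a" "inverse_pair (k + e *\<^sub>R 1) (a * a)"
    "norm (a * k * a) \<le> 1"
proof -
  have sk: "star k = k" and spec: "spectrum k \<subseteq> \<real>\<^sub>\<ge>\<^sub>0" using k by (auto simp: positive_def)
  define k' where "k' = k + e *\<^sub>R 1"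
  define M where "M = norm k + e"
  have M: "M > 0" "M > norm k" "M \<ge> e" using e norm_ge_zero[of k] by (simp_all add: M_def add_nonneg_pos)
  define z where "z = 1 - (1 / M) *\<^sub>R k'"
  have sz: "star z = z" by (simp add: z_def k'_def star_diff star_add star_scaleR sk)
  have "norm z < 1"
  proof (rule ccontr)
    assume H: "\<not> norm z < 1"
    then have "z \<noteq> 0" by auto
    then obtain c where c: "c \<in> spectrum z" "cmod c \<ge> norm z"
      using self_adjoint_spectral_radius[OF sz] by blast
    \<comment> \<open>The preimage of \<open>c\<close> under the affine map from \<open>k\<close> to
      \<open>z\<close>.\<close>
    define \<mu> where "\<mu> = M * (1 - c) - e"
    have "z - scaleC c 1 = scaleC (- (1 / M)) (k - scaleC \<mu> 1)"
      using M by (simp add: z_def k'_def \<mu>_def scaleR_scaleC scaleC_add_right scaleC_diff_right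
          scaleC_diff_left scaleC_scaleC right_diff_distrib diff_divide_distrib)
    then have "\<mu> \<in> spectrum k"
      using c(1) inverse_pair_scaleC[of "k - scaleC \<mu> 1" _ "- (1 / M)"] M
      by (auto simp: spectrum_iff)
    then obtain r where r: "\<mu> = complex_of_real r" "r \<ge> 0" using spec
      by (auto simp: nonneg_Reals_def)
    have cr: "c = complex_of_real (1 - (r + e) / M)" using M r(1) by (simp add: \<mu>_def field_simps)
    \<comment> \<open>As \<open>(r + e) / M\<close> is positive, it must be at least 2. Then
      \<open>r\<close> exceeds \<open>norm k\<close>, so \<open>1 - k / r\<close> is invertible and
      \<open>r\<close> cannot be in the spectrum.\<close>
    have "\<bar>1 - (r + e) / M\<bar> \<ge> 1" using cr c(2) H by (simp only: norm_of_real)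
    moreover have "(r + e) / M > 0" using M(1) e r by simp
    ultimately have "(r + e) / M \<ge> 2" by linarith
    then have r2: "r > norm k" using M e by (simp add: field_simps)
    then have r0: "r > 0" using norm_ge_zero[of k] by linarith
    obtain d where d: "inverse_pair (1 - (1 / r) *\<^sub>R k) (d * d)"
      by (rule self_adjoint_inverse_sqrt[of "(1 / r) *\<^sub>R k"]) (use r2 r0 sk in \<open>auto simp: star_scaleR\<close>)
    have "scaleC (- \<mu>) (1 - (1 / r) *\<^sub>R k) = k - scaleC \<mu> 1"
      using r r0 by (simp add: scaleC_diff_right scaleR_scaleC scaleC_scaleC)
    then show False using inverse_pair_scaleC[OF d, of "- \<mu>"] r r0 \<open>\<mu> \<in> spectrum k\<close>
      by (auto simp: spectrum_iff)
  qed
  then obtain c where c: "star c = c" "c * z = z * c" "inverse_pair (1 - z) (c * c)"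
    using self_adjoint_inverse_sqrt[OF sz] by blast
  define a where "a = (1 / sqrt M) *\<^sub>R c"
  have sa: "star a = a" by (simp add: a_def star_scaleR c)
  have kz: "k = M *\<^sub>R (1 - z) - e *\<^sub>R 1" using M by (simp add: z_def k'_def)
  have ak: "a * k = k * a" using c(2) by (simp add: kz a_def algebra_simps)
  have ia: "inverse_pair k' (a * a)"
  proof -
    have "k' = M *\<^sub>R (1 - z)" "a * a = (1 / M) *\<^sub>R (c * c)" using M by (simp_all add: z_def a_def)
    then show ?thesis using c(3) M by (simp add: inverse_pair_def)
  qed
  define y where "y = a * k * a"
  have y1: "y = k * (a * a)" by (simp add: y_def ak mult.assoc)
  have sy: "star y = y" by (simp add: y_def star_mult sa sk mult.assoc)
  have "norm y \<le> 1"
  proof (rule ccontr)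
    assume H: "\<not> norm y \<le> 1"
    then have "y \<noteq> 0" by auto
    then obtain l where l: "l \<in> spectrum y" "cmod l \<ge> norm y"
      using self_adjoint_spectral_radius[OF sy] by blast
    have l1: "cmod l > 1" using l(2) H by linarith
    then have l0: "1 - l \<noteq> 0" by auto
    \<comment> \<open>Solves \<open>l = \<mu> / (\<mu> + e)\<close>; for real
      \<open>\<mu> \<ge> 0\<close> this forces \<open>cmod l < 1\<close>.\<close>
    define \<mu> where "\<mu> = l * e / (1 - l)"
    have \<mu>: "\<mu> * (1 - l) = l * e" using l0 by (simp add: \<mu>_def)
    have "scaleC (1 - l) (k - scaleC \<mu> 1) = scaleC (1 - l) k - scaleC (\<mu> * (1 - l)) 1"
      by (simp add: scaleC_diff_right scaleC_scaleC mult.commute)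
    also have "\<dots> = k - scaleC l k'"
      unfolding \<mu> by (simp add: k'_def scaleC_add_right scaleC_diff_left scaleC_scaleC scaleR_scaleC)
    finally have "scaleC (1 - l) (k - scaleC \<mu> 1) = k - scaleC l k'" .
    then have "y - scaleC l 1 = scaleC (1 - l) (k - scaleC \<mu> 1) * (a * a)"
      using ia by (simp add: y1 left_diff_distrib scaleC_mult_left inverse_pair_def)
    moreover have "inverse_pair (a * a) k'" using ia by (simp add: inverse_pair_def)
    ultimately have "\<mu> \<in> spectrum k"
      using l(1) l0 inverse_pair_mult inverse_pair_scaleC[of "k - scaleC \<mu> 1" _ "1 - l"]
      unfolding spectrum_iff by metis
    then obtain r where r: "\<mu> = complex_of_real r" "r \<ge> 0" using spec
      by (auto simp: nonneg_Reals_def)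
    have "l * complex_of_real (e + r) = complex_of_real r" using \<mu> by (simp add: r algebra_simps)
    then have "cmod l * \<bar>e + r\<bar> = \<bar>r\<bar>" by (metis norm_mult norm_of_real)
    then have "cmod l * (e + r) = r" using e r by simp
    moreover have "cmod l * (e + r) \<ge> 1 * (e + r)" using l1 e r by (intro mult_right_mono) auto
    ultimately show False using e by simp
  qed
  then show ?thesis using that sa ak ia by (simp add: y_def k'_def)
qed

section \<open>Comparison of positive elements through norms of conjugates\<close>

lemma state_conjugate_mono:
  assumes f: "state f" and h: "star h = h" and k: "positive k"
    and le: "\<And>a. norm (star a * h * a) \<le> norm (star a * k * a)"
  shows "Re (f (star y * h * y)) \<le> Re (f (star y * k * y))"
proof -
  have *: "Re (f (star y * h * y)) \<le> Re (f (star y * k * y)) + e * Re (f (star y * y))"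
    if e: "e > 0" for e
  proof -
    obtain a where a: "star a = a" "a * k = k * a" "inverse_pair (k + e *\<^sub>R 1) (a * a)"
      "norm (a * k * a) \<le> 1" by (rule positive_inverse_sqrt[OF k e]) auto
    define k' where "k' = k + e *\<^sub>R 1"
    have sk: "star k' = k'" using k by (simp add: positive_def k'_def star_add star_scaleR)
    have ak: "a * k' = k' * a" by (simp add: k'_def algebra_simps a(2))
    have aa: "a * a * k' = 1" "k' * (a * a) = 1" using a(3) by (simp_all add: inverse_pair_def k'_def)
    \<comment> \<open>\<open>a * k'\<close> is the inverse of \<open>a\<close>, so \<open>x\<close>
      is the root of \<open>k'\<close> applied to \<open>y\<close>: \<open>a * x = y\<close> moves
      \<open>h\<close> into \<open>a * h * a\<close>, while \<open>star x * x\<close> is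
      \<open>star y * k' * y\<close>.\<close>
    define x where "x = a * k' * y"
    have ax: "a * x = y" using aa(1) by (simp add: x_def mult.assoc [symmetric])
    have sx: "star x * a = star y" using ax a(1) by (metis star_mult)
    have "star x * x = star y * (k' * y)"
      unfolding x_def mult.assoc[of a k' y] mult.assoc [symmetric, of "star _" a]
      using sx by (simp add: x_def mult.assoc)
    then have xx: "star x * x = star y * k * y + e *\<^sub>R (star y * y)"
      by (simp add: k'_def algebra_simps)
    have "star x * (a * h * a) * x = star y * h * y"
      using ax sx by (metis mult.assoc)
    moreover have "Re (f (star x * (a * h * a) * x)) \<le> norm (a * h * a) * Re (f (star x * x))"
      by (rule state_conjugate_le[OF f]) (simp add: star_mult a h mult.assoc)
    moreover have "norm (a * h * a) * Re (f (star x * x)) \<le> 1 * Re (f (star x * x))"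
      using le[of a] a state_facts(5)[OF f] by (intro mult_right_mono) auto
    ultimately show ?thesis by (simp add: xx state_facts[OF f])
  qed
  have "((\<lambda>e. Re (f (star y * k * y)) + e * Re (f (star y * y))) \<longlongrightarrow>
      Re (f (star y * k * y)) + 0 * Re (f (star y * y))) (at_right 0)"
    by (intro tendsto_intros)
  then have "Re (f (star y * h * y)) \<le> Re (f (star y * k * y)) + 0 * Re (f (star y * y))"
    by (rule tendsto_lowerbound)
      (use * in \<open>auto simp: eventually_at_filter\<close>)
  then show ?thesis by simp
qed

text \<open>Monotonicity in both directions makes the quadratic form of \<open>d = h - k\<close>
  vanish under \<open>f\<close>; faithfulness then turns \<open>f (star d * d) = 0\<close> into
  \<open>d = 0\<close>.\<close>

lemma positive_eqI_norm_conjugate: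
  fixes f :: "'a::cstar_algebra \<Rightarrow> complex" and h k :: 'a
  assumes f: "faithful_state f" and h: "positive h" and k: "positive k"
    and eq: "\<And>a. norm (star a * h * a) = norm (star a * k * a)"
  shows "h = k"
proof -
  have s: "state f" using f by (simp add: faithful_state_def)
  define d where "d = h - k"
  have sd: "star d = d" using h k by (simp add: d_def positive_def star_diff)
  have q: "Re (f (star y * d * y)) = 0" for y
  proof -
    have "Re (f (star y * h * y)) = Re (f (star y * k * y))"
      using h k eq by (intro antisym state_conjugate_mono[OF s]) (auto simp: positive_def)
    moreover have "star y * d * y = star y * h * y - star y * k * y"
      by (simp add: d_def algebra_simps)
    ultimately show ?thesis by (simp add: state_facts(2)[OF s])
  qed
  \<comment> \<open>polarization: the cross terms recover \<open>f (d\<^sup>2)\<close> from the vanishing quadratic form\<close>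
  have "star (d + 1) * d * (d + 1) = star d * d * d + star 1 * d * 1 + 2 *\<^sub>R (star d * d)"
    by (simp add: sd star_add algebra_simps scaleR_2)
  then have "Re (f (star d * d)) = 0"
    using q[of "d + 1"] q[of d] q[of 1] by (simp add: state_facts[OF s])
  then have "f (star d * d) = 0" using state_facts(6)[OF s, of d] by (simp add: complex_eq_iff)
  then have "d = 0" using f by (simp add: faithful_state_def)
  then show ?thesis by (simp add: d_def)
qed

subsection \<open>Hilbert modules\<close>

context hilbert_module
begin

lemma ip_add_left: "ip (x + y) z = ip x z + ip y z"
  by (metis ip_star ip_add_right star_add)

lemma ip_act_left: "ip (act x a) y = star a * ip x y"
  by (metis ip_star ip_act_right star_mult)

lemma scaleC_conv_act: "scaleC c x = act x (scaleC c 1)"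
  by (simp add: act_scaleC_right act_one)

lemma ip_scaleC_right: "ip x (scaleC c y) = scaleC c (ip x y)"
  by (simp add: scaleC_conv_act ip_act_right scaleC_mult_right)

lemma ip_scaleC_left: "ip (scaleC c x) y = scaleC (cnj c) (ip x y)"
  by (simp add: scaleC_conv_act ip_act_left star_scaleC scaleC_mult_left)

text \<open>The first bracket is \<open>ip x y + ip y x\<close>; the second, multiplied by
  \<open>- \<i>\<close>, is \<open>ip x y - ip y x\<close>.\<close>

lemma ip_polarization:
  "2 *\<^sub>R ip x y = (ip (x + y) (x + y) - ip x x - ip y y)
     - scaleC \<i> (ip (x + scaleC \<i> y) (x + scaleC \<i> y) - ip x x - ip y y)"
  by (simp add: ip_add_left ip_add_right ip_scaleC_left ip_scaleC_right scaleC_scaleC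
      scaleC_add_right scaleC_diff_right scaleR_2)

end

section \<open>Module maps and preservation of inner products\<close>

lemma module_linear_scaleC:
  assumes "hilbert_module act1 ip1" "hilbert_module act2 ip2" "module_linear act1 act2 F"
  shows "F (scaleC c x) = scaleC c (F x)"
  using assms(3) by (simp add: module_linear_def hilbert_module.scaleC_conv_act[OF assms(1)]
      hilbert_module.scaleC_conv_act[OF assms(2)])

text \<open>Isometry at every \<open>act1 x a\<close>, not just at \<open>x\<close>, equates the
  norms of all conjugates of the two diagonal inner products by \<open>a\<close>.\<close>

lemma isometry_imp_ip_preserving:
  fixes f :: "'a::cstar_algebra \<Rightarrow> complex"
    and act1 :: "'e::complex_banach \<Rightarrow> 'a \<Rightarrow> 'e" and act2 :: "'d::complex_banach \<Rightarrow> 'a \<Rightarrow> 'd"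
  assumes f: "faithful_state f" and h1: "hilbert_module act1 ip1" and h2: "hilbert_module act2 ip2"
    and F: "module_linear act1 act2 F" and iso: "\<And>x. norm (F x) = norm x"
  shows "ip1 x y = ip2 (F x) (F y)"
proof -
  interpret E: hilbert_module act1 ip1 by (fact h1)
  interpret D: hilbert_module act2 ip2 by (fact h2)
  have add: "F (x + y) = F x + F y" and act: "F (act1 x a) = act2 (F x) a" for x y a
    using F by (auto simp: module_linear_def)
  have diag: "ip1 x x = ip2 (F x) (F x)" for x
  proof (rule positive_eqI_norm_conjugate[OF f E.ip_positive D.ip_positive])
    fix a
    have "norm (ip1 (act1 x a) (act1 x a)) = norm (ip2 (act2 (F x) a) (act2 (F x) a))"
      using iso[of "act1 x a"] by (simp add: act E.norm_eq D.norm_eq)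
    then show "norm (star a * ip1 x x * a) = norm (star a * ip2 (F x) (F x) * a)"
      by (simp add: E.ip_act_left E.ip_act_right D.ip_act_left D.ip_act_right mult.assoc)
  qed
  have "2 *\<^sub>R ip1 x y = 2 *\<^sub>R ip2 (F x) (F y)"
    by (simp add: E.ip_polarization D.ip_polarization diag add module_linear_scaleC[OF h1 h2 F])
  then show ?thesis by simp
qed

lemma state_isometry_imp_ip_preserving:
  fixes f :: "'a::cstar_algebra \<Rightarrow> complex"
    and act1 :: "'e::complex_banach \<Rightarrow> 'a \<Rightarrow> 'e" and act2 :: "'d::complex_banach \<Rightarrow> 'a \<Rightarrow> 'd"
  assumes f: "faithful_state f" and h1: "hilbert_module act1 ip1" and h2: "hilbert_module act2 ip2"
    and F: "module_linear act1 act2 F" and iso: "\<And>x y. f (ip1 x y) = f (ip2 (F x) (F y))"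
  shows "ip1 x y = ip2 (F x) (F y)"
proof -
  have s: "state f" using f by (simp add: faithful_state_def)
  define d where "d = ip1 x y - ip2 (F x) (F y)"
  \<comment> \<open>Replacing \<open>y\<close> by \<open>act1 y a\<close> pulls \<open>a\<close> out
    on the right of both inner products.\<close>
  have "f (d * a) = 0" for a
    using iso[of x "act1 y a"] F
    by (simp add: d_def module_linear_def hilbert_module.ip_act_right[OF h1]
        hilbert_module.ip_act_right[OF h2] left_diff_distrib state_facts(2)[OF s])
  then have "f (star (star d) * star d) = 0" by (simp add: star_star)
  then have "star d = 0" using f unfolding faithful_state_def by blast
  then have "d = 0" by (metis star_star star_zero)
  then show ?thesis by (simp add: d_def)
qed

lemma ip_preserving_imp_norm_preserving:
  assumes "hilbert_module act1 ip1" "hilbert_module act2 ip2" "\<And>x y. ip1 x y = ip2 (F x) (F y)"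
  shows "norm (F x) = norm x"
  using assms by (simp add: hilbert_module.norm_eq[OF assms(1)] hilbert_module.norm_eq[OF assms(2)])

lemma ip_preserving_imp_bij:
  assumes h1: "hilbert_module act1 ip1" and h2: "hilbert_module act2 ip2"
    and F: "module_linear act1 act2 F" "surj F" and ip: "\<And>x y. ip1 x y = ip2 (F x) (F y)"
  shows "bij F"
proof (rule bijI[OF _ F(2)], rule injI)
  fix x y assume e: "F x = F y"
  have "F (x - y) + F y = F x" using F(1) by (metis module_linear_def diff_add_cancel)
  then have "norm (x - y) = 0"
    using ip_preserving_imp_norm_preserving[OF h1 h2 ip, of "x - y"] e by simp
  then show "x = y" by simp
qed

lemma hilbert_module_iso_imp_unitary:
  assumes h1: "hilbert_module act1 ip1" and h2: "hilbert_module act2 ip2"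
    and F: "hilbert_module_iso act1 ip1 act2 ip2 F"
  shows "unitary_op act1 ip1 act2 ip2 F"
proof -
  have b: "bij F" and m: "module_linear act1 act2 F" and ip: "ip1 x y = ip2 (F x) (F y)" for x y
    using F by (auto simp: hilbert_module_iso_def)
  have "bounded_linear F"
  proof (rule bounded_linear_intro[where K = 1])
    show "F (x + y) = F x + F y" for x y using m by (simp add: module_linear_def)
    show "F (r *\<^sub>R x) = r *\<^sub>R F x" for r x
      by (simp add: scaleR_scaleC module_linear_scaleC[OF h1 h2 m])
    show "norm (F x) \<le> norm x * 1" for x
      using ip_preserving_imp_norm_preserving[OF h1 h2 ip] by simp
  qed
  \<comment> \<open>Write the second argument as \<open>F (inv F y)\<close> and use that
    \<open>F\<close> preserves inner products.\<close>
  moreover have "is_adjoint ip1 ip2 F (inv F)"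
    using b by (simp add: is_adjoint_def ip bij_is_surj surj_f_inv_f)
  moreover have "inv F \<circ> F = id" "F \<circ> inv F = id"
    using b by (simp_all add: bij_is_inj bij_is_surj surj_iff[symmetric])
  ultimately show ?thesis using m unfolding unitary_op_def adjointable_ops_def by blast
qed

lemma unitary_imp_ip_preserving:
  assumes "unitary_op act1 ip1 act2 ip2 F"
  shows "ip1 x y = ip2 (F x) (F y)"
proof -
  obtain S where "is_adjoint ip1 ip2 F S" "S \<circ> F = id"
    using assms by (auto simp: unitary_op_def)
  then show ?thesis by (metis is_adjoint_def comp_apply id_apply)
qed

theorem theorem1:
  fixes f :: "'a::cstar_algebra \<Rightarrow> complex"
    and act1 :: "'e::complex_banach \<Rightarrow> 'a \<Rightarrow> 'e" and ip1 :: "'e \<Rightarrow> 'e \<Rightarrow> 'a"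
    and act2 :: "'d::complex_banach \<Rightarrow> 'a \<Rightarrow> 'd" and ip2 :: "'d \<Rightarrow> 'd \<Rightarrow> 'a"
    and F :: "'e \<Rightarrow> 'd"
  assumes "faithful_state f"
    and "hilbert_module act1 ip1"
    and "hilbert_module act2 ip2"
    and "module_linear act1 act2 F"
    and "surj F"
    and "unitary_op act1 ip1 act2 ip2 F \<or>
         hilbert_module_iso act1 ip1 act2 ip2 F \<or>
         (\<forall>x. norm (F x) = norm x) \<or>
         (\<forall>x y. f (ip1 x y) = f (ip2 (F x) (F y)))"
  shows "unitary_op act1 ip1 act2 ip2 F \<and>
         hilbert_module_iso act1 ip1 act2 ip2 F \<and>
         (\<forall>x. norm (F x) = norm x) \<and>
         (\<forall>x y. f (ip1 x y) = f (ip2 (F x) (F y)))"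
proof -
  have ip: "ip1 x y = ip2 (F x) (F y)" for x y
    using assms(6)
  proof (elim disjE)
    assume "\<forall>x. norm (F x) = norm x"
    then show ?thesis using isometry_imp_ip_preserving[OF assms(1-4)] by blast
  next
    assume "\<forall>x y. f (ip1 x y) = f (ip2 (F x) (F y))"
    then show ?thesis using state_isometry_imp_ip_preserving[OF assms(1-4)] by blast
  qed (auto simp: hilbert_module_iso_def dest: unitary_imp_ip_preserving)
  have iso: "hilbert_module_iso act1 ip1 act2 ip2 F"
    using ip_preserving_imp_bij[OF assms(2-5) ip] assms(4) ip by (simp add: hilbert_module_iso_def)
  then show ?thesis
    using hilbert_module_iso_imp_unitary[OF assms(2,3) iso]
      ip_preserving_imp_norm_preserving[OF assms(2,3) ip] ip by simp
qed

end
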